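(* For every derivation in $\mathsf{SKSg}$ with premise $Q$ and conclusion $P$ there exists a derivation in $\mathsf{GS1p}+\mathsf{Cut}$ with premise $\vdash\underline{Q}_{G}$ and conclusion $\vdash\underline{P}_{G}$.
   Context: Structures: generated by $S ::= \mathsf f \mid \mathsf t \mid a \mid [S,\dots,S] \mid (S,\dots,S) \mid \bar S$ (non-empty lists), where $a$ ranges over atoms, $\mathsf f,\mathsf t$ are the units false and true, $[\cdot]$ is disjunction, $(\cdot)$ is conjunction, $\bar S$ is negation; the negation of an atom is again an atom. A context $S\{\ \}$ is a structure with one occurrence of a hole, not in the scope of a negation; $S\{R\}$ is the result of filling it with $R$; $S[R,T]$ abbreviates $S\{[R,T]\}$ and $S(R,T)$ abbreviates $S\{(R,T)\}$. Equivalent structures are not distinguished; equivalence is the smallest equivalence relation induced by: $[\vec R,[\vec T],\vec U]=[\vec R,\vec T,\vec U]$ and $(\vec R,(\vec T),\vec U)=(\vec R,\vec T,\vec U)$ (with $\vec R,\vec T,\vec U$ finite sequences, $\vec T$ non-empty); $[R,T]=[T,R]$, $(R,T)=(T,R)$; $(\mathsf f,\mathsf f)=\mathsf f$, $[\mathsf f,R]=R$, $[\mathsf t,\mathsf t]=\mathsf t$, $(\mathsf t,R)=R$; $\bar{\mathsf f}=\mathsf t$, $\bar{\mathsf t}=\mathsf f$, $\overline{[R,T]}=(\bar R,\bar T)$, $\overline{(R,T)}=[\bar R,\bar T]$, $\bar{\bar R}=R$; and closure: if $R=T$ then $S\{R\}=S\{T\}$ and $\bar R=\bar T$. A derivation in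 a system (set of inference rules) is a finite sequence of rule instances, read top-down, the conclusion of each being the premise of the next; it may consist of a single structure. Its premise is the topmost structure, its conclusion the bottommost. System $\mathsf{SKSg}$ has the rules (written $\frac{\text{premise}}{\text{conclusion}}$, for arbitrary structures $R,T,U$ and contexts $S\{\ \}$): $i{\downarrow}:\frac{S\{\mathsf t\}}{S[R,\bar R]}$, $i{\uparrow}:\frac{S(R,\bar R)}{S\{\mathsf f\}}$, $s:\frac{S([R,U],T)}{S[(R,T),U]}$, $w{\downarrow}:\frac{S\{\mathsf f\}}{S\{R\}}$, $w{\uparrow}:\frac{S\{R\}}{S\{\mathsf t\}}$, $c{\downarrow}:\frac{S[R,R]}{S\{R\}}$, $c{\uparrow}:\frac{S\{R\}}{S(R,R)}$. Sequent system: formulae $A,B$ are built from atoms (closed under negation) and constants $\top,\bot$ with $\wedge,\vee$; negation occurs only on atoms and $\bar A$ denotes the De Morgan dual of $A$. Sequents are finite multisets of formulae. $\mathsf{GS1p}+\mathsf{Cut}$ has the rules: axiom $\top$: infer $\vdash\top$; $\mathsf{Ax}$: infer $\vdash A,\bar A$; $\mathsf R\wedge$: from $\vdash\Phi,A$ and $\vdash\Psi,B$ infer $\vdash\Phi,\Psi,A\wedge B$; $\mathsf R\vee$: from $\vdash\Phi,A,B$ infer $\vdash\Phi,A\vee B$; $\mathsf{RC}$: from $\vdash\Phi,A,A$ infer $\vdash\Phi,A$; $\mathsf{RW}$: from $\vdash\Phi$ infer $\vdash\Phi,A$; $\mathsf{Cut}$: from $\vdash\Phi,A$ and $\vdash\Psi,\bar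 A$ infer $\vdash\Phi,\Psi$. Derivations are trees built by these rules; the premises are the open leaves (not closed by an axiom). For the translation, structures are assumed to contain negation only on atoms and only conjunctions and disjunctions of exactly two structures (every structure is equivalent to such a one). Translation $\underline{\ \cdot\ }_G$: $\underline a_G=a$, $\underline{\mathsf t}_G=\top$, $\underline{\mathsf f}_G=\bot$, $\underline{[R,T]}_G=\underline R_G\vee\underline T_G$, $\underline{(R,T)}_G=\underline R_G\wedge\underline T_G$. *)

theory Defs
  imports Main "HOL-Library.Multiset"
begin

text \<open>
  Atoms come with a negation that is again an atom. Only involutivity is imposed; the usual
  reading (positive and negated propositional variables) is one instance.
\<close>

class atom =
  fixes neg_atom :: "'a \<Rightarrow> 'a"
  assumes neg_atom_neg_atom: "neg_atom (neg_atom a) = a"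

section \<open>Structures\<close>

text \<open>Non-empty lists of structures are represented by their head and tail.\<close>

datatype 'a str =
    FF
  | TT
  | At 'a
  | Disj "'a str" "'a str list"
  | Conj "'a str" "'a str list"
  | Neg "'a str"

text \<open>\<open>disj\<close> and \<open>conj\<close> are meaningful on non-empty lists only.\<close>

definition disj :: "'a str list \<Rightarrow> 'a str" where
  "disj Rs = Disj (hd Rs) (tl Rs)"

definition conj :: "'a str list \<Rightarrow> 'a str" where
  "conj Rs = Conj (hd Rs) (tl Rs)"

text \<open>There is no negation constructor: the hole is never in the scope of a negation.\<close>

datatype 'a ctx =
    Hole
  | DisjC "'a str list" "'a ctx" "'a str list"
  | ConjC "'a str list" "'a ctx" "'a str list"

primrec fill :: "'a ctx \<Rightarrow> 'a str \<Rightarrow> 'a str" where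
  "fill Hole R = R"
| "fill (DisjC Ls S Us) R = disj (Ls @ [fill S R] @ Us)"
| "fill (ConjC Ls S Us) R = conj (Ls @ [fill S R] @ Us)"

inductive str_eq :: "'a::atom str \<Rightarrow> 'a str \<Rightarrow> bool" (infix "\<approx>" 50) where
  refl: "R \<approx> R"
| sym: "R \<approx> T \<Longrightarrow> T \<approx> R"
| trans: "R \<approx> T \<Longrightarrow> T \<approx> U \<Longrightarrow> R \<approx> U"
| disj_assoc: "Ts \<noteq> [] \<Longrightarrow> disj (Rs @ [disj Ts] @ Us) \<approx> disj (Rs @ Ts @ Us)"
| conj_assoc: "Ts \<noteq> [] \<Longrightarrow> conj (Rs @ [conj Ts] @ Us) \<approx> conj (Rs @ Ts @ Us)"
| disj_comm: "disj [R, T] \<approx> disj [T, R]"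
| conj_comm: "conj [R, T] \<approx> conj [T, R]"
| conj_FF: "conj [FF, FF] \<approx> FF"
| disj_FF: "disj [FF, R] \<approx> R"
| disj_TT: "disj [TT, TT] \<approx> TT"
| conj_TT: "conj [TT, R] \<approx> R"
| Neg_At: "Neg (At a) \<approx> At (neg_atom a)"
| Neg_FF: "Neg FF \<approx> TT"
| Neg_TT: "Neg TT \<approx> FF"
| Neg_disj: "Neg (disj [R, T]) \<approx> conj [Neg R, Neg T]"
| Neg_conj: "Neg (conj [R, T]) \<approx> disj [Neg R, Neg T]"
| Neg_Neg: "Neg (Neg R) \<approx> R"
| ctx_closure: "R \<approx> T \<Longrightarrow> fill S R \<approx> fill S T"
| Neg_closure: "R \<approx> T \<Longrightarrow> Neg R \<approx> Neg T"

section \<open>Derivations in the calculus of structures\<close>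

text \<open>
  A system is given by its set of rule instances, as a relation between premise and conclusion.
  Structures in a derivation are only determined up to \<open>\<approx>\<close>, hence so are the
  premise and the conclusion of a derivation.
\<close>

definition derivation :: "('a::atom str \<Rightarrow> 'a str \<Rightarrow> bool) \<Rightarrow> 'a str list \<Rightarrow> bool" where
  "derivation \<S> \<Delta> \<longleftrightarrow>
     \<Delta> \<noteq> [] \<and> successively (\<lambda>Q P. \<exists>Q' P'. Q \<approx> Q' \<and> \<S> Q' P' \<and> P' \<approx> P) \<Delta>"

definition has_premise :: "'a::atom str list \<Rightarrow> 'a str \<Rightarrow> bool" where
  "has_premise \<Delta> Q \<longleftrightarrow> hd \<Delta> \<approx> Q"

definition has_conclusion :: "'a::atom str list \<Rightarrow> 'a str \<Rightarrow> bool" where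
  "has_conclusion \<Delta> P \<longleftrightarrow> last \<Delta> \<approx> P"

inductive SKSg :: "'a::atom str \<Rightarrow> 'a str \<Rightarrow> bool" where
  i_down: "SKSg (fill S TT) (fill S (disj [R, Neg R]))"
| i_up: "SKSg (fill S (conj [R, Neg R])) (fill S FF)"
| switch: "SKSg (fill S (conj [disj [R, U], T])) (fill S (disj [conj [R, T], U]))"
| w_down: "SKSg (fill S FF) (fill S R)"
| w_up: "SKSg (fill S R) (fill S TT)"
| c_down: "SKSg (fill S (disj [R, R])) (fill S R)"
| c_up: "SKSg (fill S R) (fill S (conj [R, R]))"

section \<open>The sequent calculus GS1p + Cut\<close>

datatype 'a form =
    Atom 'a
  | Top
  | Bot
  | And "'a form" "'a form"
  | Or "'a form" "'a form"

primrec dual :: "'a::atom form \<Rightarrow> 'a form" where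
  "dual (Atom a) = Atom (neg_atom a)"
| "dual Top = Bot"
| "dual Bot = Top"
| "dual (And A B) = Or (dual A) (dual B)"
| "dual (Or A B) = And (dual A) (dual B)"

type_synonym 'a sequent = "'a form multiset"

text \<open>
  \<open>GS1p_Cut \<Pi> \<Gamma>\<close>: there is a derivation tree with conclusion \<open>\<Gamma>\<close>
  whose open leaves, counted with multiplicity, are exactly \<open>\<Pi>\<close>.
\<close>

inductive GS1p_Cut :: "'a::atom sequent multiset \<Rightarrow> 'a sequent \<Rightarrow> bool" where
  open_leaf: "GS1p_Cut {#\<Gamma>#} \<Gamma>"
| Top_axiom: "GS1p_Cut {#} {#Top#}"
| Ax: "GS1p_Cut {#} {#A, dual A#}"
| RAnd: "GS1p_Cut \<Pi> (\<Phi> + {#A#}) \<Longrightarrow> GS1p_Cut \<Pi>' (\<Psi> + {#B#}) \<Longrightarrow>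
    GS1p_Cut (\<Pi> + \<Pi>') (\<Phi> + \<Psi> + {#And A B#})"
| ROr: "GS1p_Cut \<Pi> (\<Phi> + {#A, B#}) \<Longrightarrow> GS1p_Cut \<Pi> (\<Phi> + {#Or A B#})"
| RC: "GS1p_Cut \<Pi> (\<Phi> + {#A, A#}) \<Longrightarrow> GS1p_Cut \<Pi> (\<Phi> + {#A#})"
| RW: "GS1p_Cut \<Pi> \<Phi> \<Longrightarrow> GS1p_Cut \<Pi> (\<Phi> + {#A#})"
| Cut: "GS1p_Cut \<Pi> (\<Phi> + {#A#}) \<Longrightarrow> GS1p_Cut \<Pi>' (\<Psi> + {#dual A#}) \<Longrightarrow>
    GS1p_Cut (\<Pi> + \<Pi>') (\<Phi> + \<Psi>)"

section \<open>Translation\<close>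

text \<open>
  Structures with negation only on atoms and only binary conjunctions and disjunctions. The
  negation of an atom may be written either as an atom or with the negation constructor.
\<close>

inductive translatable :: "'a str \<Rightarrow> bool" where
  "translatable FF"
| "translatable TT"
| "translatable (At a)"
| "translatable (Neg (At a))"
| "translatable R \<Longrightarrow> translatable T \<Longrightarrow> translatable (disj [R, T])"
| "translatable R \<Longrightarrow> translatable T \<Longrightarrow> translatable (conj [R, T])"

lemma disj_single: "disj [T] \<approx> T"
proof -
  have "disj [FF, disj [T]] \<approx> disj [FF, T]"
    using str_eq.disj_assoc[of "[T]" "[FF]" "[]"] by simp
  from str_eq.trans[OF str_eq.sym[OF str_eq.disj_FF] str_eq.trans[OF this str_eq.disj_FF]]
  show ?thesis .
qed

lemma conj_single: "conj [T] \<approx> T"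
proof -
  have "conj [TT, conj [T]] \<approx> conj [TT, T]"
    using str_eq.conj_assoc[of "[T]" "[TT]" "[]"] by simp
  from str_eq.trans[OF str_eq.sym[OF str_eq.conj_TT] str_eq.trans[OF this str_eq.conj_TT]]
  show ?thesis .
qed

lemma disj_cong2:
  assumes "R \<approx> R'" "T \<approx> T'"
  shows "disj [R, T] \<approx> disj [R', T']"
proof (rule str_eq.trans)
  show "disj [R, T] \<approx> disj [R', T]"
    using str_eq.ctx_closure[OF assms(1), of "DisjC [] Hole [T]"] by simp
  show "disj [R', T] \<approx> disj [R', T']"
    using str_eq.ctx_closure[OF assms(2), of "DisjC [R'] Hole []"] by simp
qed

lemma conj_cong2:
  assumes "R \<approx> R'" "T \<approx> T'"
  shows "conj [R, T] \<approx> conj [R', T']"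
proof (rule str_eq.trans)
  show "conj [R, T] \<approx> conj [R', T]"
    using str_eq.ctx_closure[OF assms(1), of "ConjC [] Hole [T]"] by simp
  show "conj [R', T] \<approx> conj [R', T']"
    using str_eq.ctx_closure[OF assms(2), of "ConjC [R'] Hole []"] by simp
qed

lemma translatable_disj_list:
  "Ts \<noteq> [] \<Longrightarrow> \<forall>T\<in>set Ts. \<exists>T'. translatable T' \<and> T \<approx> T' \<Longrightarrow>
    \<exists>R'. translatable R' \<and> disj Ts \<approx> R'"
proof (induction Ts rule: list_nonempty_induct)
  case (single T)
  then show ?case using str_eq.trans[OF disj_single] by auto
next
  case (cons T Ts)
  then obtain T' R' where T': "translatable T'" "T \<approx> T'" and R': "translatable R'" "disj Ts \<approx> R'"
    by auto
  have "disj (T # Ts) \<approx> disj [T, disj Ts]"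
    using str_eq.disj_assoc[OF cons.hyps, of "[T]" "[]"] by (simp add: str_eq.sym)
  then have "disj (T # Ts) \<approx> disj [T', R']"
    by (rule str_eq.trans) (rule disj_cong2[OF T'(2) R'(2)])
  then show ?case using T'(1) R'(1) translatable.intros(5) by blast
qed

lemma translatable_conj_list:
  "Ts \<noteq> [] \<Longrightarrow> \<forall>T\<in>set Ts. \<exists>T'. translatable T' \<and> T \<approx> T' \<Longrightarrow>
    \<exists>R'. translatable R' \<and> conj Ts \<approx> R'"
proof (induction Ts rule: list_nonempty_induct)
  case (single T)
  then show ?case using str_eq.trans[OF conj_single] by auto
next
  case (cons T Ts)
  then obtain T' R' where T': "translatable T'" "T \<approx> T'" and R': "translatable R'" "conj Ts \<approx> R'"
    by auto
  have "conj (T # Ts) \<approx> conj [T, conj Ts]"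
    using str_eq.conj_assoc[OF cons.hyps, of "[T]" "[]"] by (simp add: str_eq.sym)
  then have "conj (T # Ts) \<approx> conj [T', R']"
    by (rule str_eq.trans) (rule conj_cong2[OF T'(2) R'(2)])
  then show ?case using T'(1) R'(1) translatable.intros(6) by blast
qed

lemma translatable_Neg: "translatable R \<Longrightarrow> \<exists>R'. translatable R' \<and> Neg R \<approx> R'"
proof (induction rule: translatable.induct)
  case 1
  show ?case by (intro exI conjI, rule translatable.intros(2), rule str_eq.Neg_FF)
next
  case 2
  show ?case by (intro exI conjI, rule translatable.intros(1), rule str_eq.Neg_TT)
next
  case (3 a)
  show ?case by (intro exI conjI, rule translatable.intros(4), rule str_eq.refl)
next
  case (4 a)
  show ?case by (intro exI conjI, rule translatable.intros(3), rule str_eq.Neg_Neg)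
next
  case (5 R T)
  then obtain R' T' where "translatable R'" "Neg R \<approx> R'" "translatable T'" "Neg T \<approx> T'" by auto
  then have "translatable (conj [R', T'])" "Neg (disj [R, T]) \<approx> conj [R', T']"
    by (simp_all add: translatable.intros(6) str_eq.trans[OF str_eq.Neg_disj conj_cong2])
  then show ?case by blast
next
  case (6 R T)
  then obtain R' T' where "translatable R'" "Neg R \<approx> R'" "translatable T'" "Neg T \<approx> T'" by auto
  then have "translatable (disj [R', T'])" "Neg (conj [R, T]) \<approx> disj [R', T']"
    by (simp_all add: translatable.intros(5) str_eq.trans[OF str_eq.Neg_conj disj_cong2])
  then show ?case by blast
qed

lemma ex_translatable: "\<exists>R'. translatable R' \<and> R \<approx> R'"
proof (induction R)
  case FF
  show ?case by (intro exI conjI, rule translatable.intros(1), rule str_eq.refl)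
next
  case TT
  show ?case by (intro exI conjI, rule translatable.intros(2), rule str_eq.refl)
next
  case (At a)
  show ?case by (intro exI conjI, rule translatable.intros(3), rule str_eq.refl)
next
  case (Disj R Rs)
  then show ?case using translatable_disj_list[of "R # Rs"] by (simp add: disj_def)
next
  case (Conj R Rs)
  then show ?case using translatable_conj_list[of "R # Rs"] by (simp add: conj_def)
next
  case (Neg R)
  then obtain R' where R': "translatable R'" "R \<approx> R'" by auto
  obtain R'' where "translatable R''" "Neg R' \<approx> R''" using translatable_Neg[OF R'(1)] by auto
  then show ?case using str_eq.trans[OF str_eq.Neg_closure[OF R'(2)]] by auto
qed

text \<open>Only the values on translatable structures matter.\<close>

fun trans_G :: "'a::atom str \<Rightarrow> 'a form" where
  "trans_G (At a) = Atom a"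
| "trans_G (Neg (At a)) = Atom (neg_atom a)"
| "trans_G TT = Top"
| "trans_G FF = Bot"
| "trans_G (Disj R [T]) = Or (trans_G R) (trans_G T)"
| "trans_G (Conj R [T]) = And (trans_G R) (trans_G T)"
| "trans_G _ = undefined"

end

theory Submission imports Defs begin

text \<open>
  Call \<open>A\<close> below \<open>B\<close> if \<open>\<turnstile> dual A, B\<close> is derivable without open leaves. Cut makes this a
  preorder, and the logical rules make it a Boolean algebra in which \<open>dual\<close> is the complement.
  Equivalent structures are therefore equivalent formulae, and every rule of SKSg, being sound in a
  Boolean algebra and applied in a monotone context, leads upwards. Hence the conclusion of a
  derivation is above its premise \<open>Q\<close>, and a single cut on \<open>Q\<close> turns this into a derivation
  with the one open leaf \<open>\<turnstile> Q\<close>.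
\<close>

section \<open>The Boolean algebra of formulae\<close>

definition entails :: "'a::atom form \<Rightarrow> 'a form \<Rightarrow> bool" (infix "\<preceq>" 50) where
  "A \<preceq> B \<longleftrightarrow> GS1p_Cut {#} {#dual A, B#}"

lemma dual_dual [simp]: "dual (dual A) = A"
  by (induction A) (simp_all add: neg_atom_neg_atom)

lemma entails_refl [simp]: "A \<preceq> A"
  using GS1p_Cut.Ax[of A] by (simp add: entails_def add_mset_commute)

lemma entails_trans [trans]:
  assumes "A \<preceq> B" "B \<preceq> C"
  shows "A \<preceq> C"
  using GS1p_Cut.Cut[of "{#}" "{#dual A#}" B "{#}" "{#C#}"] assms
  by (simp add: entails_def add_mset_commute)

lemma dual_antimono: "A \<preceq> B \<Longrightarrow> dual B \<preceq> dual A"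
  by (simp add: entails_def add_mset_commute)

lemma dual_entails_dual_iff [simp]: "dual B \<preceq> dual A \<longleftrightarrow> A \<preceq> B"
  using dual_antimono[of A B] dual_antimono[of "dual B" "dual A"] by auto

lemma entails_Top [simp]: "A \<preceq> Top"
  using GS1p_Cut.RW[OF GS1p_Cut.Top_axiom, of "dual A"] by (simp add: entails_def)

lemma Bot_entails [simp]: "Bot \<preceq> A"
  using dual_antimono[OF entails_Top[of "dual A"]] by simp

lemma And_entails:
  shows And_entails1: "And A B \<preceq> A" and And_entails2: "And A B \<preceq> B"
proof -
  have "GS1p_Cut {#} {#A, dual A, dual B#}" "GS1p_Cut {#} {#B, dual A, dual B#}"
    using GS1p_Cut.RW[OF GS1p_Cut.Ax[of A], of "dual B"]
      GS1p_Cut.RW[OF GS1p_Cut.Ax[of B], of "dual A"] by (simp_all add: add_mset_commute)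
  then show "And A B \<preceq> A" "And A B \<preceq> B"
    using GS1p_Cut.ROr[of "{#}" "{#A#}" "dual A" "dual B"]
      GS1p_Cut.ROr[of "{#}" "{#B#}" "dual A" "dual B"]
    by (simp_all add: entails_def add_mset_commute)
qed

lemma entails_And_iff [simp]: "C \<preceq> And A B \<longleftrightarrow> C \<preceq> A \<and> C \<preceq> B"
proof
  assume "C \<preceq> A \<and> C \<preceq> B"
  \<comment> \<open>\<open>RAnd\<close> adds up the side formulae of its premises, which leaves two
    copies of \<open>dual C\<close> for \<open>RC\<close> to merge.\<close>
  then have "GS1p_Cut {#} {#And A B, dual C, dual C#}"
    using GS1p_Cut.RAnd[of "{#}" "{#dual C#}" A "{#}" "{#dual C#}" B]
    by (simp add: entails_def add_mset_commute)
  then show "C \<preceq> And A B"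
    using GS1p_Cut.RC[of "{#}" "{#And A B#}" "dual C"]
    by (simp add: entails_def add_mset_commute)
qed (blast intro: entails_trans And_entails)

lemma Or_entails_iff [simp]: "Or A B \<preceq> C \<longleftrightarrow> A \<preceq> C \<and> B \<preceq> C"
proof -
  have "Or A B \<preceq> C \<longleftrightarrow> dual C \<preceq> And (dual A) (dual B)"
    using dual_entails_dual_iff[of C "Or A B"] by simp
  then show ?thesis by simp
qed

lemma entails_Or:
  shows entails_Or1: "A \<preceq> Or A B" and entails_Or2: "B \<preceq> Or A B"
  using Or_entails_iff[of A B "Or A B"] by simp_all

text \<open>Residuation: conjunction with \<open>B\<close> is left adjoint to
  \<open>Or (dual B)\<close>. This brings in distributivity. Each direction is one cut.\<close>

lemma And_entails_iff: "And A B \<preceq> C \<longleftrightarrow> A \<preceq> Or (dual B) C"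
proof
  assume "A \<preceq> Or (dual B) C"
  \<comment> \<open>\<open>And B (dual C)\<close> is the dual of the cut formula
    \<open>Or (dual B) C\<close>.\<close>
  moreover have "GS1p_Cut {#} {#dual B, C, And B (dual C)#}"
    using GS1p_Cut.RAnd[of "{#}" "{#dual B#}" B "{#}" "{#C#}" "dual C"]
      GS1p_Cut.Ax[of B] GS1p_Cut.Ax[of C] by (simp add: add_mset_commute)
  ultimately have "GS1p_Cut {#} {#C, dual A, dual B#}"
    using GS1p_Cut.Cut[of "{#}" "{#dual A#}" "Or (dual B) C" "{#}" "{#dual B, C#}"]
    by (simp add: entails_def add_mset_commute)
  then show "And A B \<preceq> C"
    using GS1p_Cut.ROr[of "{#}" "{#C#}" "dual A" "dual B"]
    by (simp add: entails_def add_mset_commute)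
next
  assume "And A B \<preceq> C"
  moreover have "GS1p_Cut {#} {#dual A, dual B, And A B#}"
    using GS1p_Cut.RAnd[of "{#}" "{#dual A#}" A "{#}" "{#dual B#}" B]
      GS1p_Cut.Ax[of A] GS1p_Cut.Ax[of B] by (simp add: add_mset_commute)
  ultimately have "GS1p_Cut {#} {#dual A, dual B, C#}"
    using GS1p_Cut.Cut[of "{#}" "{#dual A, dual B#}" "And A B" "{#}" "{#C#}"]
    by (simp add: entails_def add_mset_commute)
  then show "A \<preceq> Or (dual B) C"
    using GS1p_Cut.ROr[of "{#}" "{#dual A#}" "dual B" C]
    by (simp add: entails_def add_mset_commute)
qed

lemma Top_entails_Or_dual: "Top \<preceq> Or A (dual A)"
  using GS1p_Cut.RW[OF GS1p_Cut.ROr[of "{#}" "{#}" A "dual A"], of Bot] GS1p_Cut.Ax[of A]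
  by (simp add: entails_def add_mset_commute)

lemma And_dual_entails_Bot: "And A (dual A) \<preceq> Bot"
  by (simp add: And_entails_iff entails_Or)

text \<open>Residuation moves \<open>B\<close> to the right, so that the disjunction
  \<open>Or A C\<close> stands alone and splits into two cases.\<close>

lemma switch_entails: "And (Or A C) B \<preceq> Or (And A B) C"
proof -
  have "And C B \<preceq> Or (And A B) C"
    by (rule entails_trans[OF And_entails1 entails_Or2])
  then show ?thesis
    using entails_Or1[of "And A B" C] by (simp add: And_entails_iff)
qed

text \<open>The separate clause for singletons avoids a trailing \<open>Bot\<close>, so that
  two-element lists yield exactly \<open>Or A B\<close>.\<close>

fun Ors :: "'a form list \<Rightarrow> 'a form" where
  "Ors [] = Bot"
| "Ors [A] = A"
| "Ors (A # B # As) = Or A (Ors (B # As))"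

fun Ands :: "'a form list \<Rightarrow> 'a form" where
  "Ands [] = Top"
| "Ands [A] = A"
| "Ands (A # B # As) = And A (Ands (B # As))"

text \<open>The upper bounds depend only on the set of disjuncts, which makes nesting, order and
  repetition invisible.\<close>

lemma Ors_entails_iff: "Ors As \<preceq> C \<longleftrightarrow> (\<forall>A\<in>set As. A \<preceq> C)"
  by (induction As rule: Ors.induct) auto

lemma entails_Ands_iff: "C \<preceq> Ands As \<longleftrightarrow> (\<forall>A\<in>set As. C \<preceq> A)"
  by (induction As rule: Ands.induct) auto

lemma entails_Ors: "A \<in> set As \<Longrightarrow> A \<preceq> Ors As"
  using Ors_entails_iff[of As "Ors As"] by simp

lemma Ands_entails: "A \<in> set As \<Longrightarrow> Ands As \<preceq> A"
  using entails_Ands_iff[of "Ands As" As] by simp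

lemma entails_antisym_upper: "(\<And>C. A \<preceq> C \<longleftrightarrow> B \<preceq> C) \<Longrightarrow> A \<preceq> B \<and> B \<preceq> A"
  by (meson entails_refl)

lemma entails_antisym_lower: "(\<And>C. C \<preceq> A \<longleftrightarrow> C \<preceq> B) \<Longrightarrow> A \<preceq> B \<and> B \<preceq> A"
  by (meson entails_refl)

section \<open>Soundness of the calculus of structures\<close>

text \<open>Unlike \<open>trans_G\<close>, this is defined by recursion on all structures.\<close>

primrec form_of :: "'a::atom str \<Rightarrow> 'a form" where
  "form_of FF = Bot"
| "form_of TT = Top"
| "form_of (At a) = Atom a"
| "form_of (Disj R Rs) = Ors (form_of R # map form_of Rs)"
| "form_of (Conj R Rs) = Ands (form_of R # map form_of Rs)"
| "form_of (Neg R) = dual (form_of R)"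

lemma form_of_disj: "Rs \<noteq> [] \<Longrightarrow> form_of (disj Rs) = Ors (map form_of Rs)"
  by (cases Rs) (simp_all add: disj_def)

lemma form_of_conj: "Rs \<noteq> [] \<Longrightarrow> form_of (conj Rs) = Ands (map form_of Rs)"
  by (cases Rs) (simp_all add: conj_def)

text \<open>Syntactic equality holds because binary lists get no unit appended and
  \<open>dual\<close> acts on atoms by \<open>neg_atom\<close>.\<close>

lemma trans_G_eq_form_of: "translatable R \<Longrightarrow> trans_G R = form_of R"
  by (induction rule: translatable.induct) (simp_all add: disj_def conj_def)

lemma fill_mono: "form_of R \<preceq> form_of T \<Longrightarrow> form_of (fill S R) \<preceq> form_of (fill S T)"
proof (induction S)
  case (DisjC Ls S Us)
  have "form_of (fill S R) \<preceq> form_of (fill S T)"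
    using DisjC by simp
  also have "\<dots> \<preceq> Ors (map form_of (Ls @ [fill S T] @ Us))"
    by (rule entails_Ors) simp
  finally show ?case
    by (auto simp: form_of_disj Ors_entails_iff intro!: entails_Ors)
next
  case (ConjC Ls S Us)
  have "Ands (map form_of (Ls @ [fill S R] @ Us)) \<preceq> form_of (fill S R)"
    by (rule Ands_entails) simp
  also have "\<dots> \<preceq> form_of (fill S T)"
    using ConjC by simp
  finally show ?case
    by (auto simp: form_of_conj entails_Ands_iff intro!: Ands_entails)
qed simp

text \<open>Both directions go through the induction together, since symmetry and closure under
  negation swap them.\<close>

lemma str_eq_sound: "R \<approx> T \<Longrightarrow> form_of R \<preceq> form_of T \<and> form_of T \<preceq> form_of R"
proof (induction rule: str_eq.induct)
  case (trans R T U)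
  then show ?case by (blast intro: entails_trans)
next
  case (disj_assoc Ts Rs Us)
  then show ?case
    by (intro entails_antisym_upper) (auto simp: form_of_disj Ors_entails_iff)
next
  case (conj_assoc Ts Rs Us)
  then show ?case
    by (intro entails_antisym_lower) (auto simp: form_of_conj entails_Ands_iff)
next
  case (disj_comm R T)
  show ?case by (intro entails_antisym_upper) (auto simp: form_of_disj)
next
  case (conj_comm R T)
  show ?case by (intro entails_antisym_lower) (auto simp: form_of_conj)
next
  case (disj_FF R)
  show ?case by (intro entails_antisym_upper) (auto simp: form_of_disj)
next
  case (conj_TT R)
  show ?case by (intro entails_antisym_lower) (auto simp: form_of_conj)
next
  case conj_FF
  show ?case by (intro entails_antisym_lower) (auto simp: form_of_conj)
next
  case (ctx_closure R T S)
  then show ?case by (simp add: fill_mono)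
qed (simp_all add: form_of_disj form_of_conj entails_Or)

text \<open>Monotonicity strips the context, leaving one Boolean law per rule: complements for
  interaction, bounds for weakening, idempotence for contraction, distributivity for switch.\<close>

lemma SKSg_sound: "SKSg Q P \<Longrightarrow> form_of Q \<preceq> form_of P"
  by (induction rule: SKSg.induct; rule fill_mono)
    (simp_all add: form_of_disj form_of_conj Top_entails_Or_dual And_dual_entails_Bot
      switch_entails)

lemma derivation_sound:
  "derivation SKSg \<Delta> \<Longrightarrow> form_of (hd \<Delta>) \<preceq> form_of (last \<Delta>)"
proof (induction \<Delta> rule: induct_list012)
  case (3 Q P \<Delta>)
  then obtain Q' P' where "Q \<approx> Q'" "SKSg Q' P'" "P' \<approx> P"
    by (auto simp: derivation_def)
  then have "form_of Q \<preceq> form_of P"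
    by (blast dest: str_eq_sound SKSg_sound intro: entails_trans)
  also have "form_of P \<preceq> form_of (last (P # \<Delta>))"
    using 3 by (simp add: derivation_def)
  finally show ?case by simp
qed (simp_all add: derivation_def)

theorem theorem3p12:
  fixes Q P :: "'a::atom str" and \<Delta> :: "'a str list"
  assumes "derivation SKSg \<Delta>"
    and "has_premise \<Delta> Q" and "has_conclusion \<Delta> P"
    and "translatable Q" and "translatable P"
  shows "GS1p_Cut {#{#trans_G Q#}#} {#trans_G P#}"
proof -
  have "form_of Q \<preceq> form_of P"
    using assms(2,3) derivation_sound[OF assms(1)]
    unfolding has_premise_def has_conclusion_def
    by (blast dest: str_eq_sound intro: entails_trans)
  \<comment> \<open>The sum is arranged to match the right premise of \<open>Cut\<close>; the left
    premise is the open leaf, with no side formulae.\<close>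
  then have "GS1p_Cut {#} ({#form_of P#} + {#dual (form_of Q)#})"
    by (simp add: entails_def add_mset_commute)
  from GS1p_Cut.Cut[of "{#{#form_of Q#}#}" "{#}", OF _ this]
  show ?thesis
    using GS1p_Cut.open_leaf[of "{#form_of Q#}"] assms(4,5) by (simp add: trans_G_eq_form_of)
qed

end
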